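(* Let $X$ be a real Hilbert space, let $(C_i)_{i\in I}$ be a finite family of closed convex subsets of $X$ with $C:=\bigcap_{i\in I}C_i\neq\varnothing$, where $I=I_0\cup I_1$ is a disjoint union such that for every $i\in I_0$ we have $C_i=(Z_i)_{[\beta_i]}$ for a nonempty closed convex set $Z_i\subseteq X$ and some $\beta_i>0$. Let $(\lambda_i)_{i\in I_1}$ be a family in $]0,2[$. For $i\in I_0$ let $T_i$ be the intrepid projector onto $C_i$ with respect to $Z_i$ and $\beta_i$; for $i\in I_1$ let $T_i:=(1-\lambda_i)\operatorname{Id}+\lambda_i P_{C_i}$. Let $\mathrm{i}\colon\mathbb{N}\to I$ be a quasicyclic control, i.e., there is an integer $M\geq 1$ such that $I=\{\mathrm{i}(k),\mathrm{i}(k+1),\ldots,\mathrm{i}(k+M-1)\}$ for every $k\in\mathbb{N}$. Let $x_0\in X$ and set $x_{k+1}:=T_{\mathrm{i}(k)}x_k$ for every $k\in\mathbb{N}$. Suppose that $$\bigcap_{i\in I_1}C_i\cap\bigcap_{i\in I_0}\operatorname{int}C_i\neq\varnothing .$$ Then $(x_k)_{k\in\mathbb{N}}$ converges weakly to some point in $C$. Moreover, the convergence is strong provided one of the following conditions holds: (i) $X$ is finite-dimensional; (ii) $I_1$ is either empty or a singleton.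
   Context: For a nonempty closed convex subset $S$ of the Hilbert space $X$, $d_S(x):=\inf_{s\in S}\|x-s\|$ is the distance from $x$ to $S$, and $P_S$ is the (metric) projection onto $S$. An intersection over an empty index set equals $X$. Enlargement: for a nonempty closed convex $Z\subseteq X$ and $\alpha\geq 0$, $Z_{[\alpha]}:=\{x\in X : d_Z(x)\leq\alpha\}$. Intrepid projector: for a nonempty closed convex $Z\subseteq X$, $\beta>0$ and $C=Z_{[\beta]}$, the intrepid projector $Q\colon X\to X$ onto $C$ (with respect to $Z$ and $\beta$) is defined by $$Qx=\begin{cases}P_Zx,&\text{if } d_Z(x)\geq 2\beta;\\ x,&\text{if } d_Z(x)\leq\beta;\\ x+\Big(1-\frac{d_Z(x)}{\beta}\Big)(x-P_Zx),&\text{otherwise.}\end{cases}$$ *)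

theory Defs
  imports "HOL-Analysis.Analysis"
begin

(* The library's closest_point requires the sort heine_borel, i.e. local compactness, and is
   therefore unavailable in infinite dimensions.  In a Hilbert space the nearest point exists and
   is unique whenever S is nonempty, closed and convex; otherwise the value may be unspecified. *)
definition metric_proj :: "'a::real_inner set \<Rightarrow> 'a \<Rightarrow> 'a" where
  "metric_proj S x = (THE p. p \<in> S \<and> dist x p = infdist x S)"

(* infdist x Z is the distance d_Z(x) for nonempty Z (the library sets infdist x {} = 0). *)
definition enlargement :: "'a::real_inner set \<Rightarrow> real \<Rightarrow> 'a set" where
  "enlargement Z \<alpha> = {x. infdist x Z \<le> \<alpha>}"

definition intrepid_projector :: "'a::real_inner set \<Rightarrow> real \<Rightarrow> 'a \<Rightarrow> 'a" where
  "intrepid_projector Z \<beta> x =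
     (if infdist x Z \<ge> 2 * \<beta> then metric_proj Z x
      else if infdist x Z \<le> \<beta> then x
      else x + (1 - infdist x Z / \<beta>) *\<^sub>R (x - metric_proj Z x))"

definition relaxed_projector :: "'a::real_inner set \<Rightarrow> real \<Rightarrow> 'a \<Rightarrow> 'a" where
  "relaxed_projector S l x = (1 - l) *\<^sub>R x + l *\<^sub>R metric_proj S x"

definition quasicyclic :: "'i set \<Rightarrow> (nat \<Rightarrow> 'i) \<Rightarrow> bool" where
  "quasicyclic I ctrl \<longleftrightarrow> (\<exists>M\<ge>1. \<forall>k. I = ctrl ` {k..k + M - 1})"

definition weakly_converges_to :: "(nat \<Rightarrow> 'a::real_normed_vector) \<Rightarrow> 'a \<Rightarrow> bool" where
  "weakly_converges_to x c \<longleftrightarrow>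
     (\<forall>f :: 'a \<Rightarrow> real. bounded_linear f \<longrightarrow> (\<lambda>k. f (x k)) \<longlonglongrightarrow> f c)"

end

theory Submission
  imports Defs
begin

text \<open>
  Let \<open>z\<close> be a Slater point whose ball of radius \<open>r\<close> lies in every \<open>C i\<close> with \<open>i \<in> I\<^sub>0\<close>.
  The intrepid projector is a relaxed projector onto \<open>C i\<close> whose relaxation parameter may reach 2, so
  it does not bring the iterates strictly closer to every point of \<open>C i\<close>; being Fejer
  monotone with respect to a whole ball around \<open>z\<close>, however, it decreases \<open>norm (x k - z)\<^sup>2\<close> by at
  least \<open>2 * r\<close> times the length of its step. Together with the usual quadratic decrease
  for relaxed projectors, all steps and the distances to the active sets tend to 0, and
  quasicyclicity extends this to the distances to all \<open>C i\<close>.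

  Weak convergence then follows from Fejer monotonicity. Instead of weak cluster points we use points
  lying in every closed convex set that eventually contains a given subsequence; they exist
  because nested bounded closed convex sets have a common point.

  For strong convergence with \<open>I\<^sub>1 \<subseteq> {j}\<close>, the steps have finite total length: those of the intrepid
  projectors by the linear decrease, and those of \<open>T j\<close> because they shrink the distance to
  \<open>C j\<close> by a fixed factor, while the others can increase it only by their own length.
\<close>

section \<open>Projections in Hilbert space\<close>

lemma ex_dist_less_infdist:
  assumes "A \<noteq> {}" "0 < e"
  shows "\<exists>a\<in>A. dist x a < infdist x A + e"
proof -
  have "(INF a\<in>A. dist x a) < infdist x A + e"
    using infdist_notempty[OF assms(1)] assms(2) by simp
  then show ?thesis
    by (simp only: cINF_less_iff[OF assms(1) bdd_below_image_dist])
qed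

text \<open>Take \<open>u n\<close> in \<open>K n\<close> of almost minimal norm. For
  \<open>n \<le> p\<close> the midpoint of \<open>u n\<close> and \<open>u p\<close> lies in
  \<open>K n\<close>, so its norm is at least \<open>m n\<close>, and the parallelogram law makes
  \<open>u\<close> Cauchy. Its limit lies in every \<open>K n\<close>. This replaces weak
  compactness throughout.\<close>

lemma nested_closed_convex_Inter_nonempty:
  fixes K :: "nat \<Rightarrow> 'a::{real_inner,complete_space} set"
  assumes clo: "\<And>n. closed (K n)" and conv: "\<And>n. convex (K n)"
    and ne: "\<And>n. K n \<noteq> {}" and dec: "decseq K" and bdd: "bounded (K 0)"
  shows "(\<Inter>n. K n) \<noteq> {}"
proof -
  define m where "m n = infdist 0 (K n)" for n
  have sub: "K n \<subseteq> K k" if "k \<le> n" for k n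
    using decseqD[OF dec that] .
  have m0: "0 \<le> m n" for n
    by (simp add: m_def infdist_nonneg)
  have inc: "incseq m"
    unfolding incseq_def m_def using sub ne by (blast intro: infdist_mono)
  obtain B where B: "\<And>u. u \<in> K 0 \<Longrightarrow> norm u \<le> B"
    using bdd unfolding bounded_iff by blast
  have mB: "m n \<le> B" for n
  proof -
    obtain u where "u \<in> K n" using ne by blast
    then show ?thesis using B[of u] sub[of 0 n] infdist_le[of u "K n" 0]
      by (auto simp: m_def)
  qed
  obtain L where L: "m \<longlonglongrightarrow> L" "\<And>n. m n \<le> L"
    using incseq_convergent[OF inc] mB by metis
  have "\<exists>u\<in>K n. norm u < m n + 1 / real (Suc n)" for n
    using ex_dist_less_infdist[OF ne, where e = "1 / real (Suc n)" and x = 0] by (simp add: m_def)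
  then obtain u where u: "\<And>n. u n \<in> K n" "\<And>n. norm (u n) < m n + 1 / real (Suc n)"
    by metis
  have uK: "u p \<in> K n" if "n \<le> p" for n p
    using u(1) sub that by blast
  \<comment> \<open>The parallelogram law bounds \<open>(norm (u n - u p))\<^sup>2\<close> by this:
    both norms are at most \<open>L + 1 / Suc n\<close>, and the sum has norm at least
    \<open>2 * m n\<close>. It vanishes in the limit because \<open>m\<close> tends to
    \<open>L\<close>.\<close>
  define e where "e n = 4 * (L + 1 / real (Suc n))\<^sup>2 - 4 * (m n)\<^sup>2" for n
  have "e \<longlonglongrightarrow> 4 * (L + 0)\<^sup>2 - 4 * L\<^sup>2"
    unfolding e_def by (intro tendsto_intros L LIMSEQ_Suc[OF lim_1_over_n])
  then have e0: "e \<longlonglongrightarrow> 0" by simp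
  have close: "(norm (u n - u p))\<^sup>2 \<le> e n" if "n \<le> p" for n p
  proof -
    have "(1/2) *\<^sub>R u n + (1/2) *\<^sub>R u p \<in> K n"
      using convexD[OF conv uK[of n n] uK[OF that], of "1/2" "1/2"] by simp
    then have "m n \<le> norm ((1/2) *\<^sub>R (u n + u p))"
      using infdist_le[of _ "K n" 0] by (fastforce simp: m_def scaleR_add_right)
    then have "(2 * m n)\<^sup>2 \<le> (norm (u n + u p))\<^sup>2"
      using m0 by (intro power_mono) auto
    moreover have "(norm (u n - u p))\<^sup>2 = 2 * (norm (u n))\<^sup>2 + 2 * (norm (u p))\<^sup>2 - (norm (u n + u p))\<^sup>2"
      by (simp add: power2_norm_eq_inner inner_simps inner_commute)
    moreover have "(norm (u n))\<^sup>2 \<le> (L + 1 / real (Suc n))\<^sup>2"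
      using u(2)[of n] L(2)[of n] by (intro power_mono) auto
    moreover have "(norm (u p))\<^sup>2 \<le> (L + 1 / real (Suc n))\<^sup>2"
    proof -
      have "1 / real (Suc p) \<le> 1 / real (Suc n)" using that by (simp add: frac_le)
      then show ?thesis using u(2)[of p] L(2)[of p] by (intro power_mono) auto
    qed
    ultimately show ?thesis unfolding e_def power_mult_distrib by simp
  qed
  have "Cauchy u"
  proof (rule metric_CauchyI)
    fix \<epsilon> :: real assume "0 < \<epsilon>"
    then have "eventually (\<lambda>n. e n < (\<epsilon>/2)\<^sup>2) sequentially"
      using order_tendstoD(2)[OF e0] by simp
    then obtain N where N: "e N < (\<epsilon>/2)\<^sup>2" by (auto simp: eventually_sequentially)
    have "dist (u N) (u p) < \<epsilon>/2" if "N \<le> p" for p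
      using close[OF that] N \<open>0 < \<epsilon>\<close> unfolding dist_norm
      by (intro power2_less_imp_less[of _ "\<epsilon>/2"]) auto
    then have "dist (u a) (u b) < \<epsilon>" if "N \<le> a" "N \<le> b" for a b
      using that dist_triangle_half_r by blast
    then show "\<exists>M. \<forall>m\<ge>M. \<forall>n\<ge>M. dist (u m) (u n) < \<epsilon>" by blast
  qed
  then obtain l where l: "u \<longlonglongrightarrow> l"
    using Cauchy_convergent_iff convergent_def by blast
  have "l \<in> K n" for n
  proof (rule Lim_in_closed_set[OF clo _ _ l])
    show "eventually (\<lambda>p. u p \<in> K n) sequentially"
      using uK by (auto simp: eventually_sequentially)
  qed simp
  then show ?thesis by blast
qed

text \<open>The points of \<open>S\<close> at distance at most
  \<open>infdist x S + 1 / Suc n\<close> form a nested sequence of bounded closed convex sets, and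
  any common point is nearest.\<close>

lemma nearest_point_exists:
  fixes S :: "'a::{real_inner,complete_space} set"
  assumes "S \<noteq> {}" "closed S" "convex S"
  shows "\<exists>p\<in>S. dist x p = infdist x S"
proof -
  define K where "K n = S \<inter> cball x (infdist x S + 1 / real (Suc n))" for n
  have "(\<Inter>n. K n) \<noteq> {}"
  proof (rule nested_closed_convex_Inter_nonempty)
    show "K n \<noteq> {}" for n
      using ex_dist_less_infdist[OF assms(1), of "1 / real (Suc n)" x]
      by (auto simp: K_def intro: less_imp_le)
    show "decseq K" unfolding decseq_def
    proof (intro allI impI)
      fix m n :: nat assume "m \<le> n"
      then have "1 / real (Suc n) \<le> 1 / real (Suc m)" by (simp add: frac_le)
      then show "K n \<subseteq> K m" by (auto simp: K_def)
    qed
  qed (auto simp: K_def assms convex_Int)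
  then obtain p where p: "\<And>n. p \<in> K n" by blast
  have "(\<lambda>n. infdist x S + 1 / real (Suc n)) \<longlonglongrightarrow> infdist x S + 0"
    by (intro tendsto_intros LIMSEQ_Suc[OF lim_1_over_n])
  then have "dist x p \<le> infdist x S + 0"
    by (rule LIMSEQ_le_const) (use p in \<open>auto simp: K_def\<close>)
  moreover have "p \<in> S" using p[of 0] by (simp add: K_def)
  ultimately show ?thesis using infdist_le[of p S x] by force
qed

lemma metric_proj_nearest:
  fixes S :: "'a::{real_inner,complete_space} set"
  assumes "S \<noteq> {}" "closed S" "convex S"
  shows "metric_proj S x \<in> S" "dist x (metric_proj S x) = infdist x S"
proof -
  obtain p where p: "p \<in> S" "dist x p = infdist x S"
    using nearest_point_exists[OF assms] by blast
  have "metric_proj S x = p" unfolding metric_proj_def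
  proof (rule the_equality)
    fix q assume q: "q \<in> S \<and> dist x q = infdist x S"
    show "q = p"
    proof (rule any_closest_point_unique[OF assms(3,2), of _ _ x])
      show "\<forall>z\<in>S. dist x q \<le> dist x z" "\<forall>z\<in>S. dist x p \<le> dist x z"
        using q p(2) by (simp_all add: infdist_le)
    qed (use q p in simp_all)
  qed (use p in simp)
  then show "metric_proj S x \<in> S" "dist x (metric_proj S x) = infdist x S" using p by simp_all
qed

lemma metric_proj_inner_le_0:
  fixes S :: "'a::{real_inner,complete_space} set"
  assumes "S \<noteq> {}" "closed S" "convex S" "y \<in> S"
  shows "inner (x - metric_proj S x) (y - metric_proj S x) \<le> 0"
proof (rule any_closest_point_dot[OF assms(3,2) _ assms(4)])
  show "\<forall>z\<in>S. dist x (metric_proj S x) \<le> dist x z"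
    unfolding metric_proj_nearest(2)[OF assms(1-3)] by (simp add: infdist_le)
qed (rule metric_proj_nearest[OF assms(1-3)])

section \<open>Relaxed and intrepid projectors\<close>

text \<open>Both kinds of projector move \<open>x\<close> along \<open>x - p\<close>, where
  \<open>p\<close> is a projection of \<open>x\<close>. Each Fejer estimate thus reduces to an upper
  bound for \<open>inner (x - p) (c - p)\<close>.\<close>

lemma norm_step_towards:
  fixes x :: "'a::real_inner"
  shows "(norm (x - t *\<^sub>R (x - p) - c))\<^sup>2
    = (norm (x - c))\<^sup>2 + t\<^sup>2 * (norm (x - p))\<^sup>2
      - 2 * t * ((norm (x - p))\<^sup>2 - inner (x - p) (c - p))"
proof -
  define a where "a = x - c"
  define b where "b = x - p"
  have e: "x - t *\<^sub>R (x - p) - c = a - t *\<^sub>R b" "c - p = b - a"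
    by (simp_all add: a_def b_def)
  show ?thesis
    unfolding e unfolding a_def[symmetric] b_def[symmetric] power2_norm_eq_inner
    by (simp add: inner_diff_left inner_diff_right inner_commute[of b a] power2_eq_square algebra_simps)
qed

lemma relaxed_projector_eq:
  "relaxed_projector S l x = x - l *\<^sub>R (x - metric_proj S x)"
  by (simp add: relaxed_projector_def algebra_simps)

lemma relaxed_projector_fejer:
  fixes S :: "'a::{real_inner,complete_space} set"
  assumes "S \<noteq> {}" "closed S" "convex S" "0 \<le> l" "c \<in> S"
  shows "(norm (relaxed_projector S l x - c))\<^sup>2 \<le> (norm (x - c))\<^sup>2 - l * (2 - l) * (infdist x S)\<^sup>2"
proof -
  define p where "p = metric_proj S x"
  have d: "norm (x - p) = infdist x S"
    using metric_proj_nearest[OF assms(1-3)] by (simp add: p_def dist_norm)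
  have "l * inner (x - p) (c - p) \<le> 0"
    using metric_proj_inner_le_0[OF assms(1-3,5)] assms(4)
    unfolding p_def by (rule mult_nonneg_nonpos[rotated])
  then show ?thesis
    unfolding relaxed_projector_eq p_def[symmetric] norm_step_towards d
    by (simp add: algebra_simps power2_eq_square)
qed

lemma relaxed_projector_displacement:
  fixes S :: "'a::{real_inner,complete_space} set"
  assumes "S \<noteq> {}" "closed S" "convex S" "0 \<le> l"
  shows "norm (relaxed_projector S l x - x) = l * infdist x S"
  using metric_proj_nearest[OF assms(1-3), of x] assms(4)
  by (simp add: relaxed_projector_eq dist_norm)

text \<open>The projection of \<open>x\<close> is still a point of \<open>S\<close>, and the new
  point lies on the line through it. For \<open>0 < l < 2\<close> the factor is below 1, which
  yields finite total step length when only one relaxed projector occurs.\<close>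

lemma infdist_relaxed_projector_le:
  fixes S :: "'a::{real_inner,complete_space} set"
  assumes "S \<noteq> {}" "closed S" "convex S"
  shows "infdist (relaxed_projector S l x) S \<le> \<bar>1 - l\<bar> * infdist x S"
proof -
  define p where "p = metric_proj S x"
  have p: "p \<in> S" "norm (x - p) = infdist x S"
    using metric_proj_nearest[OF assms] by (simp_all add: p_def dist_norm)
  have "relaxed_projector S l x - p = (1 - l) *\<^sub>R (x - p)"
    by (simp add: relaxed_projector_def p_def algebra_simps)
  then have "dist (relaxed_projector S l x) p = \<bar>1 - l\<bar> * infdist x S"
    using p by (simp add: dist_norm)
  then show ?thesis using infdist_le[OF p(1), of "relaxed_projector S l x"] by simp
qed

text \<open>Treats the three cases of the definition uniformly, with \<open>t\<close> equal to 1, 0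
  or \<open>infdist x Z / \<beta> - 1\<close>. A nonzero step has length between one and two times
  \<open>infdist x Z - \<beta>\<close>. The upper bound carries an extra factor \<open>t\<close> so
  that it stays true for \<open>t = 0\<close>, where \<open>infdist x Z - \<beta>\<close> may be
  negative.\<close>

lemma intrepid_projector_step:
  fixes Z :: "'a::{real_inner,complete_space} set"
  assumes "Z \<noteq> {}" "closed Z" "convex Z" "0 < \<beta>"
  obtains t where "0 \<le> t" "intrepid_projector Z \<beta> x = x - t *\<^sub>R (x - metric_proj Z x)"
    "infdist x Z - \<beta> \<le> t * infdist x Z"
    "t * (t * infdist x Z) \<le> t * (2 * (infdist x Z - \<beta>))"
proof -
  define d where "d = infdist x Z"
  consider "2 * \<beta> \<le> d" | "d \<le> \<beta>" | "\<beta> < d" "d < 2 * \<beta>" by linarith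
  then show thesis
  proof cases
    case 1
    then show ?thesis using assms(4)
      by (intro that[of 1]) (auto simp: intrepid_projector_def d_def)
  next
    case 2
    then show ?thesis using assms(4)
      by (intro that[of 0]) (auto simp: intrepid_projector_def d_def)
  next
    case 3
    define t where "t = d / \<beta> - 1"
    have t: "0 \<le> t" "t * d = (d - \<beta>) * (d / \<beta>)"
      using 3 assms(4) by (auto simp: t_def field_simps)
    have "(d - \<beta>) * 1 \<le> t * d" unfolding t(2)
      using 3 assms(4) by (intro mult_left_mono) auto
    moreover have "t * d \<le> (d - \<beta>) * 2" unfolding t(2)
      using 3 assms(4) by (intro mult_left_mono) (auto simp: field_simps)
    then have "t * (t * d) \<le> t * (2 * (d - \<beta>))"
      using t(1) by (intro mult_left_mono) auto
    moreover have "intrepid_projector Z \<beta> x = x - t *\<^sub>R (x - metric_proj Z x)"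
      using 3 by (simp add: intrepid_projector_def d_def[symmetric] t_def algebra_simps)
    ultimately show ?thesis using t(1) by (intro that[of t]) (auto simp: d_def)
  qed
qed

text \<open>Passing from \<open>c\<close> to its projection \<open>q\<close> on \<open>Z\<close>
  costs at most \<open>\<beta>\<close>, so \<open>inner (x - p) (c - p)\<close> is at most
  \<open>d * \<beta>\<close>. A step of length at most \<open>2 * (d - \<beta>)\<close> is then at
  most a reflection and cannot increase the distance to \<open>c\<close>.\<close>

lemma intrepid_projector_fejer:
  fixes Z :: "'a::{real_inner,complete_space} set"
  assumes Z: "Z \<noteq> {}" "closed Z" "convex Z" and \<beta>: "0 < \<beta>" and c: "c \<in> enlargement Z \<beta>"
  shows "norm (intrepid_projector Z \<beta> x - c) \<le> norm (x - c)"
proof -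
  obtain t where t: "0 \<le> t" "intrepid_projector Z \<beta> x = x - t *\<^sub>R (x - metric_proj Z x)"
    "t * (t * infdist x Z) \<le> t * (2 * (infdist x Z - \<beta>))"
    using intrepid_projector_step[OF Z \<beta>] by metis
  define d where "d = infdist x Z"
  define p where "p = metric_proj Z x"
  define q where "q = metric_proj Z c"
  have d: "norm (x - p) = d" "0 \<le> d"
    using metric_proj_nearest[OF Z] by (simp_all add: p_def d_def dist_norm infdist_nonneg)
  have q: "q \<in> Z" "norm (c - q) \<le> \<beta>"
    using metric_proj_nearest[OF Z, of c] c by (simp_all add: q_def dist_norm enlargement_def)
  have "inner (x - p) (c - q) \<le> d * \<beta>"
    using norm_cauchy_schwarz[of "x - p" "c - q"] q(2) d
    by (meson mult_left_mono order_trans d(1) eq_refl mult_mono norm_ge_zero)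
  moreover have "inner (x - p) (q - p) \<le> 0"
    unfolding p_def by (rule metric_proj_inner_le_0[OF Z q(1)])
  moreover have "inner (x - p) (c - p) = inner (x - p) (c - q) + inner (x - p) (q - p)"
    by (simp add: inner_simps)
  ultimately have i: "inner (x - p) (c - p) \<le> d * \<beta>" by linarith
  have "t * (2 * (d * (d - \<beta>))) \<le> t * (2 * (d\<^sup>2 - inner (x - p) (c - p)))"
    using t(1) i by (intro mult_left_mono) (auto simp: algebra_simps power2_eq_square)
  moreover have "t\<^sup>2 * d\<^sup>2 \<le> t * (2 * (d * (d - \<beta>)))"
    using mult_right_mono[OF t(3) d(2)] unfolding d_def
    by (simp add: power2_eq_square algebra_simps)
  ultimately have "(norm (intrepid_projector Z \<beta> x - c))\<^sup>2 \<le> (norm (x - c))\<^sup>2"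
    unfolding t(2) p_def[symmetric] norm_step_towards d(1) by (simp add: algebra_simps)
  then show ?thesis by (rule power2_le_imp_le) simp
qed

lemma infdist_enlargement_le_intrepid:
  fixes Z :: "'a::{real_inner,complete_space} set"
  assumes Z: "Z \<noteq> {}" "closed Z" "convex Z" and \<beta>: "0 < \<beta>"
  shows "infdist x (enlargement Z \<beta>) \<le> norm (intrepid_projector Z \<beta> x - x)"
proof (cases "infdist x Z \<le> \<beta>")
  case True
  then have "x \<in> enlargement Z \<beta>" by (simp add: enlargement_def)
  then show ?thesis by simp
next
  case False
  obtain t where t: "0 \<le> t" "intrepid_projector Z \<beta> x = x - t *\<^sub>R (x - metric_proj Z x)"
    "infdist x Z - \<beta> \<le> t * infdist x Z"
    using intrepid_projector_step[OF Z \<beta>] by metis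
  define d where "d = infdist x Z"
  define p where "p = metric_proj Z x"
  \<comment> \<open>The point of the segment from \<open>p\<close> to \<open>x\<close> at distance
    \<open>\<beta>\<close> from \<open>p\<close>: it lies in the enlargement, at distance
    \<open>d - \<beta>\<close> from \<open>x\<close>.\<close>
  define w where "w = p + (\<beta> / d) *\<^sub>R (x - p)"
  have d: "norm (x - p) = d" "\<beta> < d"
    using metric_proj_nearest[OF Z] False by (simp_all add: p_def d_def dist_norm)
  have pZ: "p \<in> Z" using metric_proj_nearest[OF Z] by (simp add: p_def)
  have "dist w p = \<beta>" using d \<beta> by (simp add: w_def dist_norm)
  then have w: "w \<in> enlargement Z \<beta>"
    using infdist_le[OF pZ, of w] by (simp add: enlargement_def)
  have "x - w = (1 - \<beta> / d) *\<^sub>R (x - p)" by (simp add: w_def algebra_simps)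
  then have "dist x w = \<bar>1 - \<beta> / d\<bar> * d" using d by (simp add: dist_norm)
  also have "\<dots> = d - \<beta>" using d \<beta> by (simp add: field_simps)
  also have "\<dots> \<le> norm (intrepid_projector Z \<beta> x - x)"
    using t d by (simp add: p_def[symmetric] d_def)
  finally show ?thesis using infdist_le[OF w, of x] by simp
qed

text \<open>Comparing \<open>x\<close> and \<open>y\<close> at the point of the ball that lies farthest in the direction \<open>x - y\<close>
  turns nonexpansiveness into a decrease that is linear, not quadratic, in the step.\<close>

lemma fejer_ball_decrease:
  fixes x y z :: "'a::real_inner"
  assumes r: "0 < r" and fej: "\<And>c. c \<in> cball z r \<Longrightarrow> norm (y - c) \<le> norm (x - c)"
  shows "2 * r * norm (y - x) \<le> (norm (x - z))\<^sup>2 - (norm (y - z))\<^sup>2"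
proof (cases "y = x")
  case False
  define n where "n = norm (y - x)"
  define c where "c = z - (r / n) *\<^sub>R (y - x)"
  have n: "0 < n" using False by (simp add: n_def)
  have "c \<in> cball z r" using r n by (simp add: c_def dist_norm n_def)
  then have "(norm (y - c))\<^sup>2 \<le> (norm (x - c))\<^sup>2" using fej by (intro power_mono) auto
  moreover have "(norm (y - c))\<^sup>2 - (norm (x - c))\<^sup>2
      = (norm (y - z))\<^sup>2 - (norm (x - z))\<^sup>2 + 2 * ((r / n) * inner (y - x) (y - x))"
    unfolding c_def power2_norm_eq_inner by (simp add: inner_simps inner_commute algebra_simps)
  moreover have "(r / n) * inner (y - x) (y - x) = r * n"
    using n by (simp add: power2_norm_eq_inner[symmetric] n_def power2_eq_square)
  ultimately have "2 * (r * n) \<le> (norm (x - z))\<^sup>2 - (norm (y - z))\<^sup>2" by linarith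
  then show ?thesis by (simp add: n_def mult.assoc)
qed simp

section \<open>Weak convergence of Fejer monotone sequences\<close>

text \<open>The point \<open>c\<close> plays the role of a weak cluster point, but is obtained
  without weak compactness.\<close>

lemma asymptotic_hull_point_exists:
  fixes y :: "nat \<Rightarrow> 'a::{real_inner,complete_space}"
  assumes bdd: "bounded (range y)"
  obtains c where "\<And>H. closed H \<Longrightarrow> convex H \<Longrightarrow> \<forall>\<^sub>F n in sequentially. y n \<in> H \<Longrightarrow> c \<in> H"
proof -
  \<comment> \<open>Closed convex hulls of the tails. They are nested and bounded, so they have a
    common point, and any admissible \<open>H\<close> contains one of them.\<close>
  define K where "K n = (\<lambda>S. closed S \<and> convex S) hull (y ` {n..})" for n
  have K: "closed (K n) \<and> convex (K n)" for n
    unfolding K_def by (rule hull_in) (auto intro: closed_Inter convex_Inter)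
  have yK: "y k \<in> K n" if "n \<le> k" for n k
    using that hull_subset[of "y ` {n..}" "\<lambda>S. closed S \<and> convex S"] by (auto simp: K_def)
  have Kmin: "K n \<subseteq> H" if "closed H" "convex H" "\<And>k. n \<le> k \<Longrightarrow> y k \<in> H" for n H
    unfolding K_def using that by (intro hull_minimal) auto
  obtain B where B: "\<And>n. norm (y n) \<le> B"
    using bdd unfolding bounded_iff by blast
  have "K 0 \<subseteq> cball 0 B" by (rule Kmin) (auto simp: B)
  then have "bounded (K 0)" using bounded_cball bounded_subset by blast
  moreover have "decseq K" unfolding decseq_def
    using K yK by (intro allI impI Kmin) (auto intro: order_trans)
  ultimately have "(\<Inter>n. K n) \<noteq> {}"
    using K yK by (intro nested_closed_convex_Inter_nonempty) blast+
  then obtain c where c: "\<And>n. c \<in> K n" by blast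
  show thesis
  proof (rule that[of c])
    fix H assume H: "closed H" "convex H" "\<forall>\<^sub>F n in sequentially. y n \<in> H"
    then obtain N where "\<And>n. N \<le> n \<Longrightarrow> y n \<in> H" by (auto simp: eventually_sequentially)
    then show "c \<in> H" using Kmin[OF H(1,2), of N] c by blast
  qed
qed

text \<open>The half-space with normal \<open>c - p\<close> that supports \<open>S\<close> at the
  projection \<open>p\<close> of \<open>c\<close>, shifted outwards by \<open>e\<close>, eventually
  contains \<open>y n\<close>. Hence it contains \<open>c\<close>, which forces
  \<open>inner (c - p) (c - p) \<le> e\<close>.\<close>

lemma asymptotic_hull_point_mem:
  fixes S :: "'a::{real_inner,complete_space} set"
  assumes c: "\<And>H. closed H \<Longrightarrow> convex H \<Longrightarrow> \<forall>\<^sub>F n in sequentially. y n \<in> H \<Longrightarrow> c \<in> H"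
    and S: "S \<noteq> {}" "closed S" "convex S"
    and lim: "(\<lambda>n. infdist (y n) S) \<longlonglongrightarrow> 0"
  shows "c \<in> S"
proof -
  define p where "p = metric_proj S c"
  have p: "p \<in> S" using metric_proj_nearest[OF S] by (simp add: p_def)
  have "inner (c - p) (c - p) \<le> 0 + e" if e: "0 < e" for e
  proof -
    define H where "H = {u. inner (c - p) u \<le> inner (c - p) p + e}"
    have "(\<lambda>n. norm (c - p) * infdist (y n) S) \<longlonglongrightarrow> norm (c - p) * 0"
      by (intro tendsto_intros lim)
    then have "\<forall>\<^sub>F n in sequentially. norm (c - p) * infdist (y n) S < e"
      using e by (intro order_tendstoD) auto
    then have "\<forall>\<^sub>F n in sequentially. y n \<in> H"
    proof eventually_elim
      case (elim n)
      define q where "q = metric_proj S (y n)"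
      have q: "q \<in> S" "norm (y n - q) = infdist (y n) S"
        using metric_proj_nearest[OF S, of "y n"] by (simp_all add: q_def dist_norm)
      have "inner (c - p) (q - p) \<le> 0"
        unfolding p_def by (rule metric_proj_inner_le_0[OF S q(1)])
      moreover have "inner (c - p) (y n - q) \<le> norm (c - p) * infdist (y n) S"
        unfolding q(2)[symmetric] by (rule norm_cauchy_schwarz)
      ultimately show ?case using elim by (simp add: H_def inner_diff_right)
    qed
    moreover have "closed H" "convex H"
      unfolding H_def by (rule closed_halfspace_le convex_halfspace_le)+
    ultimately have "c \<in> H" using c by blast
    then show ?thesis by (simp add: H_def inner_diff_right)
  qed
  then have "inner (c - p) (c - p) \<le> 0" by (rule field_le_epsilon)
  then have "c - p = 0" by (metis inner_eq_zero_iff inner_ge_zero antisym)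
  then show ?thesis using p by simp
qed

lemma asymptotic_hull_point_inner:
  fixes c :: "'a::real_inner"
  assumes c: "\<And>H. closed H \<Longrightarrow> convex H \<Longrightarrow> \<forall>\<^sub>F n in sequentially. y n \<in> H \<Longrightarrow> c \<in> H"
    and lim: "(\<lambda>n. inner v (y n)) \<longlonglongrightarrow> L"
  shows "inner v c = L"
proof (rule antisym)
  show "inner v c \<le> L"
  proof (rule field_le_epsilon)
    fix e :: real assume "0 < e"
    then have "\<forall>\<^sub>F n in sequentially. inner v (y n) < L + e"
      using lim by (intro order_tendstoD) auto
    then have "c \<in> {u. inner v u \<le> L + e}"
      by (intro c closed_halfspace_le convex_halfspace_le) (auto elim: eventually_mono)
    then show "inner v c \<le> L + e" by simp
  qed
  show "L \<le> inner v c"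
  proof (rule field_le_epsilon)
    fix e :: real assume "0 < e"
    then have "\<forall>\<^sub>F n in sequentially. L - e < inner v (y n)"
      using lim by (intro order_tendstoD) auto
    then have "c \<in> {u. inner v u \<ge> L - e}"
      by (intro c closed_halfspace_ge convex_halfspace_ge) (auto elim: eventually_mono)
    then show "L \<le> inner v c + e" by simp
  qed
qed

text \<open>An Opial-type argument. Hull points of subsequences lie in all \<open>C i\<close>, and
  convergence of the distances to such points forces them all to equal one point \<open>c\<close>.
  If \<open>f (x k)\<close> stayed away from \<open>f c\<close> infinitely often, a hull point of
  that subsequence would lie in a half-space missing \<open>c\<close>.\<close>

lemma fejer_weak_convergence:
  fixes x :: "nat \<Rightarrow> 'a::{real_inner,complete_space}" and C :: "'i \<Rightarrow> 'a set"
  assumes C: "\<And>i. i \<in> I \<Longrightarrow> closed (C i) \<and> convex (C i)" and ne: "(\<Inter>i\<in>I. C i) \<noteq> {}"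
    and fejer: "\<And>c k. c \<in> (\<Inter>i\<in>I. C i) \<Longrightarrow> norm (x (Suc k) - c) \<le> norm (x k - c)"
    and lim: "\<And>i. i \<in> I \<Longrightarrow> (\<lambda>k. infdist (x k) (C i)) \<longlonglongrightarrow> 0"
  obtains c where "c \<in> (\<Inter>i\<in>I. C i)" "weakly_converges_to x c"
proof -
  obtain z where z: "z \<in> (\<Inter>i\<in>I. C i)" using ne by blast
  have mono: "decseq (\<lambda>k. norm (x k - c))" if "c \<in> (\<Inter>i\<in>I. C i)" for c
    using fejer[OF that] by (simp add: decseq_Suc_iff)
  have conv: "convergent (\<lambda>k. norm (x k - c))" if "c \<in> (\<Inter>i\<in>I. C i)" for c
    using decseq_convergent[OF mono[OF that], of 0] by (auto simp: convergent_def)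
  have "norm (x k) \<le> norm (x 0 - z) + norm z" for k
    using decseqD[OF mono[OF z], of 0 k] norm_triangle_ineq[of "x k - z" z] by simp
  then have bdd: "bounded (range x)" unfolding bounded_iff by blast
  have mem: "a \<in> (\<Inter>i\<in>I. C i)" if s: "strict_mono s"
    and a: "\<And>H. closed H \<Longrightarrow> convex H \<Longrightarrow> \<forall>\<^sub>F n in sequentially. x (s n) \<in> H \<Longrightarrow> a \<in> H"
    for a and s :: "nat \<Rightarrow> nat"
  proof
    fix i assume i: "i \<in> I"
    show "a \<in> C i"
    proof (rule asymptotic_hull_point_mem[of "\<lambda>n. x (s n)"])
      show "(\<lambda>n. infdist (x (s n)) (C i)) \<longlonglongrightarrow> 0"
        using LIMSEQ_subseq_LIMSEQ[OF lim[OF i] s] by (simp add: comp_def)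
    qed (use a C[OF i] z i in auto)
  qed
  obtain c where c: "\<And>H. closed H \<Longrightarrow> convex H \<Longrightarrow> \<forall>\<^sub>F n in sequentially. x n \<in> H \<Longrightarrow> c \<in> H"
    using asymptotic_hull_point_exists[OF bdd] by metis
  have cC: "c \<in> (\<Inter>i\<in>I. C i)" using mem[of id c] c by (simp add: strict_mono_id)
  \<comment> \<open>\<open>norm (x k - b)\<^sup>2 - norm (x k - a)\<^sup>2\<close> converges, so \<open>inner (a - b)\<close> takes the same value
    at all hull points of subsequences.\<close>
  have uniq: "a = b" if s: "strict_mono s"
    and a: "\<And>H. closed H \<Longrightarrow> convex H \<Longrightarrow> \<forall>\<^sub>F n in sequentially. x (s n) \<in> H \<Longrightarrow> a \<in> H"
    and b: "\<And>H. closed H \<Longrightarrow> convex H \<Longrightarrow> \<forall>\<^sub>F n in sequentially. x n \<in> H \<Longrightarrow> b \<in> H"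
    for a b and s :: "nat \<Rightarrow> nat"
  proof -
    have aC: "a \<in> (\<Inter>i\<in>I. C i)" using s a by (rule mem)
    have bC: "b \<in> (\<Inter>i\<in>I. C i)" using mem[of id b] b by (simp add: strict_mono_id)
    obtain La Lb where L: "(\<lambda>k. norm (x k - a)) \<longlonglongrightarrow> La" "(\<lambda>k. norm (x k - b)) \<longlonglongrightarrow> Lb"
      using conv[OF aC] conv[OF bC] by (auto simp: convergent_def)
    have eq: "inner (a - b) (x k) = ((norm (x k - b))\<^sup>2 - (norm (x k - a))\<^sup>2 + (norm a)\<^sup>2 - (norm b)\<^sup>2) / 2" for k
      unfolding power2_norm_eq_inner
      by (simp add: inner_diff_left inner_diff_right inner_commute[of a "x k"] inner_commute[of b "x k"])
    define l where "l = (Lb\<^sup>2 - La\<^sup>2 + (norm a)\<^sup>2 - (norm b)\<^sup>2) / 2"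
    have l: "(\<lambda>k. inner (a - b) (x k)) \<longlonglongrightarrow> l"
      unfolding eq l_def by (intro tendsto_intros L) simp
    have "inner (a - b) b = l" by (rule asymptotic_hull_point_inner[OF b l])
    moreover have "inner (a - b) a = l"
    proof (rule asymptotic_hull_point_inner[of "\<lambda>n. x (s n)"])
      show "(\<lambda>n. inner (a - b) (x (s n))) \<longlonglongrightarrow> l"
        using LIMSEQ_subseq_LIMSEQ[OF l s] by (simp add: comp_def)
    qed (rule a)
    ultimately have "inner (a - b) (a - b) = 0" by (simp add: inner_diff_right)
    then show ?thesis by simp
  qed
  \<comment> \<open>A one-sided bound suffices, since it also applies to the negative of
    \<open>f\<close>.\<close>
  have upper: "\<forall>\<^sub>F k in sequentially. f (x k) < f c + e" if f: "bounded_linear f" and e: "0 < e"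
    for f :: "'a \<Rightarrow> real" and e
  proof (rule ccontr)
    interpret f: bounded_linear f by (rule f)
    assume "\<not> ?thesis"
    then have "\<forall>N. \<exists>n>N. f c + e \<le> f (x n)"
      unfolding eventually_at_top_dense by (meson not_le)
    then have "infinite {n. f c + e \<le> f (x n)}" by (simp add: infinite_nat_iff_unbounded)
    then obtain s :: "nat \<Rightarrow> nat" where s: "strict_mono s" "\<And>n. f c + e \<le> f (x (s n))"
      using infinite_enumerate by blast
    have "bounded (range (\<lambda>n. x (s n)))"
      by (rule bounded_subset[OF bdd]) auto
    then obtain a where a: "\<And>H. closed H \<Longrightarrow> convex H \<Longrightarrow> \<forall>\<^sub>F n in sequentially. x (s n) \<in> H \<Longrightarrow> a \<in> H"
      using asymptotic_hull_point_exists[of "\<lambda>n. x (s n)"] by metis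
    have "a = c" using s(1) a c by (rule uniq)
    have "a \<in> f -` {f c + e..}"
    proof (rule a)
      show "closed (f -` {f c + e..})"
        by (rule closed_vimage) (auto intro: f.continuous_on continuous_on_id)
      show "convex (f -` {f c + e..})"
        by (rule convex_linear_vimage) (simp_all add: f.linear_axioms)
      show "\<forall>\<^sub>F n in sequentially. x (s n) \<in> f -` {f c + e..}" using s(2) by simp
    qed
    then show False using \<open>a = c\<close> e by simp
  qed
  have "weakly_converges_to x c" unfolding weakly_converges_to_def
  proof (intro allI impI order_tendstoI)
    fix f :: "'a \<Rightarrow> real" and u assume f: "bounded_linear f"
    show "\<forall>\<^sub>F k in sequentially. f (x k) < u" if "f c < u"
      using upper[OF f, of "u - f c"] that by simp
    show "\<forall>\<^sub>F k in sequentially. u < f (x k)" if "u < f c"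
      using upper[OF bounded_linear_minus[OF f], of "f c - u"] that by simp
  qed
  then show thesis using cC that by blast
qed

section \<open>From weak to strong limits; finite dimension\<close>

lemma weakly_converges_to_inner:
  assumes "weakly_converges_to x c"
  shows "(\<lambda>k. inner v (x k)) \<longlonglongrightarrow> inner v c"
  using assms bounded_linear_inner_right unfolding weakly_converges_to_def by blast

lemma weakly_converges_to_eq_limit:
  fixes x :: "nat \<Rightarrow> 'a::real_inner"
  assumes "weakly_converges_to x c" "x \<longlonglongrightarrow> l"
  shows "l = c"
proof -
  have "(\<lambda>k. inner (l - c) (x k)) \<longlonglongrightarrow> inner (l - c) l"
    by (intro tendsto_intros assms)
  then have "inner (l - c) l = inner (l - c) c"
    using weakly_converges_to_inner[OF assms(1)] LIMSEQ_unique by blast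
  then have "inner (l - c) (l - c) = 0" by (simp add: inner_diff_right)
  then show ?thesis by simp
qed

lemma orthogonal_spanning_expansion:
  fixes w :: "'a::real_inner"
  assumes "finite E" "pairwise orthogonal E" "w \<in> span E"
  shows "w = (\<Sum>e\<in>E. (inner e w / inner e e) *\<^sub>R e)"
proof -
  obtain a where a: "w = (\<Sum>e\<in>E. a e *\<^sub>R e)"
    using assms(3) unfolding span_finite[OF assms(1)] by blast
  have "inner e w = a e * inner e e" if e: "e \<in> E" for e
  proof -
    have "inner e w = (\<Sum>b\<in>E. a b * inner e b)" by (simp add: a inner_sum_right)
    also have "\<dots> = (\<Sum>b\<in>E. if b = e then a e * inner e e else 0)"
      using assms(2) e by (intro sum.cong) (auto simp: pairwise_def orthogonal_def)
    finally show ?thesis using assms(1) e by simp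
  qed
  \<comment> \<open>The orthogonal family \<open>E\<close> may contain 0; there the quotient is 0 by
    convention, and both sides vanish whatever \<open>a e\<close> is.\<close>
  then have "(inner e w / inner e e) *\<^sub>R e = a e *\<^sub>R e" if "e \<in> E" for e
    using that by (cases "e = 0") auto
  then show ?thesis unfolding a[symmetric] by (metis (no_types, lifting) a sum.cong)
qed

lemma weakly_converges_to_finite_dim:
  fixes x :: "nat \<Rightarrow> 'a::real_inner"
  assumes fin: "finite B" "span B = (UNIV :: 'a set)" and w: "weakly_converges_to x c"
  shows "x \<longlonglongrightarrow> c"
proof -
  obtain E where E: "finite E" "span E = span B" "pairwise orthogonal E"
    using basis_orthogonal[OF fin(1)] by blast
  have ex: "u = (\<Sum>e\<in>E. (inner e u / inner e e) *\<^sub>R e)" for u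
    using E fin by (intro orthogonal_spanning_expansion) auto
  \<comment> \<open>With \<open>inverse\<close> in place of division each coefficient is a constant
    multiple of an inner product, so it converges even for \<open>e = 0\<close>.\<close>
  have "(\<lambda>k. \<Sum>e\<in>E. (inner e (x k) * inverse (inner e e)) *\<^sub>R e)
      \<longlonglongrightarrow> (\<Sum>e\<in>E. (inner e c * inverse (inner e e)) *\<^sub>R e)"
    by (intro tendsto_intros weakly_converges_to_inner w)
  then show ?thesis unfolding divide_inverse[symmetric] ex[symmetric] .
qed

section \<open>Strong convergence and control of the steps\<close>

text \<open>By telescoping, the total length of the steps is at most \<open>W 0 / \<delta>\<close>,
  so the sequence is Cauchy.\<close>

lemma convergent_if_step_le_decrease:
  fixes x :: "nat \<Rightarrow> 'a::{real_normed_vector,complete_space}"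
  assumes "0 < \<delta>" and dec: "\<And>k. \<delta> * norm (x (Suc k) - x k) \<le> W k - W (Suc k)"
    and nonneg: "\<And>k. 0 \<le> W k"
  shows "convergent x"
proof -
  have "(\<Sum>k<n. norm (x (Suc k) - x k)) \<le> W 0 / \<delta>" for n
  proof -
    have "\<delta> * (\<Sum>k<n. norm (x (Suc k) - x k)) \<le> (\<Sum>k<n. W k - W (Suc k))"
      unfolding sum_distrib_left by (intro sum_mono dec)
    also have "\<dots> = W 0 - W n" by (rule sum_lessThan_telescope')
    also have "\<dots> \<le> W 0" using nonneg by simp
    finally show ?thesis using assms(1) by (simp add: field_simps)
  qed
  then have s: "summable (\<lambda>k. norm (x (Suc k) - x k))"
    by (intro summableI_nonneg_bounded) auto
  have "Cauchy x"
  proof (rule metric_CauchyI)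
    fix e :: real assume "0 < e"
    then obtain N where N: "\<And>m n. N \<le> m \<Longrightarrow> norm (\<Sum>k=m..<n. norm (x (Suc k) - x k)) < e"
      using s unfolding summable_Cauchy by blast
    have *: "dist (x m) (x n) < e" if "N \<le> m" "m \<le> n" for m n
    proof -
      have "x n - x m = (\<Sum>k=m..<n. x (Suc k) - x k)" using that by (simp add: sum_Suc_diff')
      then have "norm (x n - x m) \<le> (\<Sum>k=m..<n. norm (x (Suc k) - x k))" by (simp add: norm_sum)
      then show ?thesis using N[OF that(1), of n] by (simp add: dist_norm norm_minus_commute)
    qed
    show "\<exists>M. \<forall>m\<ge>M. \<forall>n\<ge>M. dist (x m) (x n) < e"
      using * by (metis dist_commute nle_le)
  qed
  then show ?thesis by (simp add: Cauchy_convergent_iff)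
qed

lemma norm_diff_le_sum_steps:
  fixes x :: "nat \<Rightarrow> 'a::real_normed_vector"
  shows "norm (x (k + l) - x k) \<le> (\<Sum>m<l. norm (x (Suc (k + m)) - x (k + m)))"
proof (induction l)
  case (Suc l)
  have "norm (x (k + Suc l) - x k) \<le> norm (x (Suc (k + l)) - x (k + l)) + norm (x (k + l) - x k)"
    using norm_triangle_ineq[of "x (Suc (k + l)) - x (k + l)" "x (k + l) - x k"] by simp
  then show ?case using Suc by simp
qed simp

text \<open>Every window of \<open>M\<close> indices contains a visit to \<open>i\<close>. Up to
  that visit the sequence travels at most \<open>G k\<close>, and at the visit its distance to
  \<open>C i\<close> is at most \<open>G k\<close>. The bound \<open>h\<close> may depend on the
  active index; summing over the finite \<open>I\<close> gives a single null sequence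
  \<open>g\<close>.\<close>

lemma quasicyclic_infdist_tendsto_0:
  fixes x :: "nat \<Rightarrow> 'a::real_normed_vector" and C :: "'i \<Rightarrow> 'a set"
  assumes fin: "finite I" and q: "quasicyclic I ctrl"
    and h0: "\<And>i. i \<in> I \<Longrightarrow> h i \<longlonglongrightarrow> 0" and hnn: "\<And>i k. i \<in> I \<Longrightarrow> 0 \<le> h i k"
    and step: "\<And>k. norm (x (Suc k) - x k) \<le> h (ctrl k) k"
    and near: "\<And>k. infdist (x k) (C (ctrl k)) \<le> h (ctrl k) k"
    and i: "i \<in> I"
  shows "(\<lambda>k. infdist (x k) (C i)) \<longlonglongrightarrow> 0"
proof -
  obtain M where M: "1 \<le> M" "\<And>k. I = ctrl ` {k..k + M - 1}"
    using q unfolding quasicyclic_def by blast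
  have ctrlI: "ctrl k \<in> I" for k using M(1) by (subst M(2)[of k]) auto
  define g where "g k = (\<Sum>j\<in>I. h j k)" for k
  have g0: "g \<longlonglongrightarrow> 0" unfolding g_def using h0 by (rule tendsto_null_sum)
  have gnn: "0 \<le> g k" for k unfolding g_def by (intro sum_nonneg hnn)
  have hg: "h (ctrl k) k \<le> g k" for k
    unfolding g_def using ctrlI by (intro member_le_sum fin hnn) auto
  define G where "G k = (\<Sum>m<M. g (k + m))" for k
  have "G \<longlonglongrightarrow> 0" unfolding G_def
    by (intro tendsto_null_sum LIMSEQ_ignore_initial_segment g0)
  then have G0: "(\<lambda>k. 2 * G k) \<longlonglongrightarrow> 0" by (rule tendsto_mult_right_zero)
  have bound: "infdist (x k) (C i) \<le> 2 * G k" for k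
  proof -
    obtain n where n: "i = ctrl n" "n \<in> {k..k + M - 1}" using i M(2)[of k] by blast
    define l where "l = n - k"
    \<comment> \<open>\<open>1 \<le> M\<close> keeps \<open>k + M - 1\<close> from truncating at 0,
      so the offset is strictly below \<open>M\<close>.\<close>
    have l: "l < M" "n = k + l" using n(2) M(1) by (auto simp: l_def)
    have "(\<Sum>m<l. norm (x (Suc (k + m)) - x (k + m))) \<le> (\<Sum>m<l. g (k + m))"
      using step hg by (intro sum_mono) (meson order_trans)
    also have "\<dots> \<le> G k" unfolding G_def using l gnn by (intro sum_mono2) auto
    finally have "dist (x k) (x n) \<le> G k"
      using norm_diff_le_sum_steps[of x k l] l by (simp add: dist_norm norm_minus_commute)
    moreover have "g (k + l) \<le> G k"
      unfolding G_def using l gnn by (intro member_le_sum) auto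
    then have "infdist (x n) (C i) \<le> G k" using near[of n] hg[of n] n(1) l(2) by simp
    ultimately show ?thesis using infdist_triangle[of "x k" "C i" "x n"] by linarith
  qed
  show ?thesis
    by (rule tendsto_sandwich[OF _ _ tendsto_const G0]) (auto simp: infdist_nonneg bound)
qed

section \<open>Convergence of the iteration\<close>

theorem theorem14:
  fixes C Z :: "'i \<Rightarrow> ('a :: {real_inner, complete_space}) set"
    and I I\<^sub>0 I\<^sub>1 :: "'i set"
    and \<beta> lam :: "'i \<Rightarrow> real"
    and T :: "'i \<Rightarrow> 'a \<Rightarrow> 'a"
    and ctrl :: "nat \<Rightarrow> 'i"
    and x :: "nat \<Rightarrow> 'a"
    and x\<^sub>0 :: 'a
  assumes "finite I"
    and "I = I\<^sub>0 \<union> I\<^sub>1" and "I\<^sub>0 \<inter> I\<^sub>1 = {}"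
    and "\<And>i. i \<in> I \<Longrightarrow> closed (C i) \<and> convex (C i)"
    and "(\<Inter>i\<in>I. C i) \<noteq> {}"
    and "\<And>i. i \<in> I\<^sub>0 \<Longrightarrow> Z i \<noteq> {} \<and> closed (Z i) \<and> convex (Z i)"
    and "\<And>i. i \<in> I\<^sub>0 \<Longrightarrow> \<beta> i > 0"
    and "\<And>i. i \<in> I\<^sub>0 \<Longrightarrow> C i = enlargement (Z i) (\<beta> i)"
    and "\<And>i. i \<in> I\<^sub>1 \<Longrightarrow> 0 < lam i \<and> lam i < 2"
    and "\<And>i. i \<in> I\<^sub>0 \<Longrightarrow> T i = intrepid_projector (Z i) (\<beta> i)"
    and "\<And>i. i \<in> I\<^sub>1 \<Longrightarrow> T i = relaxed_projector (C i) (lam i)"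
    and "quasicyclic I ctrl"
    and "x 0 = x\<^sub>0"
    and "\<And>k. x (Suc k) = T (ctrl k) (x k)"
    and "(\<Inter>i\<in>I\<^sub>1. C i) \<inter> (\<Inter>i\<in>I\<^sub>0. interior (C i)) \<noteq> {}"
  shows "\<exists>c \<in> (\<Inter>i\<in>I. C i).
           weakly_converges_to x c \<and>
           ((\<exists>B :: 'a set. finite_dimensional_vector_space (*\<^sub>R) B) \<or>
            I\<^sub>1 = {} \<or> is_singleton I\<^sub>1 \<longrightarrow> x \<longlonglongrightarrow> c)"
proof -
  note un = assms(2) and CC = assms(4) and ZZ = assms(6) and \<beta> = assms(7)
    and Ceq = assms(8) and lam = assms(9) and T0 = assms(10) and T1 = assms(11)
    and qc = assms(12) and xS = assms(14)
  have fin: "finite I\<^sub>0" "finite I\<^sub>1" using assms(1) un by auto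
  have ctrlI: "ctrl k \<in> I" for k
  proof -
    obtain M where "1 \<le> M" "I = ctrl ` {k..k + M - 1}" using qc unfolding quasicyclic_def by blast
    then show ?thesis by auto
  qed
  obtain z where z: "z \<in> (\<Inter>i\<in>I\<^sub>1. C i)" "z \<in> (\<Inter>i\<in>I\<^sub>0. interior (C i))" using assms(15) by blast
  \<comment> \<open>Finiteness of \<open>I\<^sub>0\<close> gives one radius for all its sets. If
    \<open>I\<^sub>0\<close> is empty, the intersection is the whole space and any positive
    \<open>r\<close> serves.\<close>
  have "open (\<Inter>i\<in>I\<^sub>0. interior (C i))" using fin by (intro open_INT) auto
  then obtain r where r: "0 < r" "cball z r \<subseteq> (\<Inter>i\<in>I\<^sub>0. interior (C i))"
    using z(2) open_contains_cball by blast
  have ball: "cball z r \<subseteq> C i" if "i \<in> I\<^sub>0" for i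
    using r(2) that interior_subset[of "C i"] by blast
  have zC: "z \<in> (\<Inter>i\<in>I. C i)" using z interior_subset un by blast
  have ne: "C i \<noteq> {}" if "i \<in> I" for i using zC that by blast
  have step0: "x (Suc k) = intrepid_projector (Z (ctrl k)) (\<beta> (ctrl k)) (x k)" if "ctrl k \<in> I\<^sub>0" for k
    using xS T0[OF that] by simp
  have step1: "x (Suc k) = relaxed_projector (C (ctrl k)) (lam (ctrl k)) (x k)" if "ctrl k \<in> I\<^sub>1" for k
    using xS T1[OF that] by simp
  have C1: "C i \<noteq> {}" "closed (C i)" "convex (C i)" "0 \<le> lam i" if "i \<in> I\<^sub>1" for i
    using ne CC un lam[OF that] that by auto
  have fej0: "norm (x (Suc k) - c) \<le> norm (x k - c)" if "ctrl k \<in> I\<^sub>0" "c \<in> C (ctrl k)" for k c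
    unfolding step0[OF that(1)] using ZZ[OF that(1)] \<beta>[OF that(1)] Ceq[OF that(1)] that(2)
    by (intro intrepid_projector_fejer) auto
  have fej1: "lam (ctrl k) * (2 - lam (ctrl k)) * (infdist (x k) (C (ctrl k)))\<^sup>2
      \<le> (norm (x k - c))\<^sup>2 - (norm (x (Suc k) - c))\<^sup>2" if "ctrl k \<in> I\<^sub>1" "c \<in> C (ctrl k)" for k c
    using relaxed_projector_fejer[OF C1[OF that(1)] that(2), of "x k"] step1[OF that(1)] by simp
  have fejer: "norm (x (Suc k) - c) \<le> norm (x k - c)" if c: "c \<in> (\<Inter>i\<in>I. C i)" for k c
  proof (cases "ctrl k \<in> I\<^sub>0")
    case True
    then show ?thesis using c ctrlI by (intro fej0) auto
  next
    case False
    then have k: "ctrl k \<in> I\<^sub>1" using ctrlI un by blast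
    have "0 \<le> lam (ctrl k) * (2 - lam (ctrl k)) * (infdist (x k) (C (ctrl k)))\<^sup>2"
      using lam[OF k] by simp
    moreover have "c \<in> C (ctrl k)" using c ctrlI by blast
    ultimately have "(norm (x (Suc k) - c))\<^sup>2 \<le> (norm (x k - c))\<^sup>2"
      using fej1[OF k, of c] by linarith
    then show ?thesis by (rule power2_le_imp_le) simp
  qed
  define V where "V k = (norm (x k - z))\<^sup>2" for k
  have V0: "0 \<le> V k" and Vdec: "V (Suc k) \<le> V k" for k
    using fejer[OF zC] by (auto simp: V_def intro: power_mono)
  have Vstep0: "2 * r * norm (x (Suc k) - x k) \<le> V k - V (Suc k)" if k: "ctrl k \<in> I\<^sub>0" for k
    unfolding V_def using ball[OF k] by (intro fejer_ball_decrease r fej0[OF k]) auto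
  have Vstep1: "lam (ctrl k) * (2 - lam (ctrl k)) * (infdist (x k) (C (ctrl k)))\<^sup>2 \<le> V k - V (Suc k)"
    if k: "ctrl k \<in> I\<^sub>1" for k
    unfolding V_def using fej1[OF k, of z] zC ctrlI by auto
  have disp1: "norm (x (Suc k) - x k) = lam (ctrl k) * infdist (x k) (C (ctrl k))" if k: "ctrl k \<in> I\<^sub>1" for k
    unfolding step1[OF k] by (rule relaxed_projector_displacement[OF C1[OF k]])
  obtain L where "V \<longlonglongrightarrow> L"
    using decseq_convergent[of V 0] decseq_SucI[of V] V0 Vdec by metis
  then have "(\<lambda>k. V k - V (Suc k)) \<longlonglongrightarrow> L - L" by (intro tendsto_diff LIMSEQ_Suc)
  then have dV: "(\<lambda>k. V k - V (Suc k)) \<longlonglongrightarrow> 0" by simp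
  \<comment> \<open>Obtained by solving \<open>Vstep0\<close> for the step and \<open>Vstep1\<close>
    for the distance. A relaxed step has length \<open>lam i\<close> times the distance, so the
    factor \<open>1 + lam i\<close> covers both the step and the distance.\<close>
  define h where "h i k = (if i \<in> I\<^sub>0 then (V k - V (Suc k)) / (2 * r)
    else (1 + lam i) * sqrt ((V k - V (Suc k)) / (lam i * (2 - lam i))))" for i k
  have lim: "(\<lambda>k. infdist (x k) (C i)) \<longlonglongrightarrow> 0" if "i \<in> I" for i
  proof (rule quasicyclic_infdist_tendsto_0[OF assms(1) qc _ _ _ _ that])
    show "h j \<longlonglongrightarrow> 0" if j: "j \<in> I" for j
    proof (cases "j \<in> I\<^sub>0")
      case True
      have "(\<lambda>k. (V k - V (Suc k)) / (2 * r)) \<longlonglongrightarrow> 0 / (2 * r)"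
        by (intro tendsto_intros dV) (use r in auto)
      then show ?thesis using True by (simp add: h_def[abs_def])
    next
      case False
      then have "lam j * (2 - lam j) \<noteq> 0" using lam[of j] j un by auto
      then have "(\<lambda>k. (1 + lam j) * sqrt ((V k - V (Suc k)) / (lam j * (2 - lam j))))
          \<longlonglongrightarrow> (1 + lam j) * sqrt (0 / (lam j * (2 - lam j)))"
        by (intro tendsto_intros dV)
      then show ?thesis using False by (simp add: h_def[abs_def])
    qed
    show "0 \<le> h j k" if "j \<in> I" for j k
      using that r Vdec[of k] lam[of j] un by (auto simp: h_def)
    fix k
    have "norm (x (Suc k) - x k) \<le> h (ctrl k) k \<and> infdist (x k) (C (ctrl k)) \<le> h (ctrl k) k"
    proof (cases "ctrl k \<in> I\<^sub>0")
      case True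
      have "norm (x (Suc k) - x k) \<le> h (ctrl k) k"
        using Vstep0[OF True] r True by (simp add: h_def field_simps)
      moreover have "infdist (x k) (C (ctrl k)) \<le> norm (x (Suc k) - x k)"
        unfolding step0[OF True] Ceq[OF True] using ZZ[OF True] \<beta>[OF True]
        by (intro infdist_enlargement_le_intrepid) auto
      ultimately show ?thesis by linarith
    next
      case False
      then have k: "ctrl k \<in> I\<^sub>1" using ctrlI un by blast
      define l where "l = lam (ctrl k)"
      define d where "d = infdist (x k) (C (ctrl k))"
      define s where "s = sqrt ((V k - V (Suc k)) / (l * (2 - l)))"
      have l: "0 < l" "l < 2" using lam[OF k] by (auto simp: l_def)
      have d0: "0 \<le> d" by (simp add: d_def infdist_nonneg)
      have "d\<^sup>2 \<le> (V k - V (Suc k)) / (l * (2 - l))"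
        using Vstep1[OF k] l unfolding l_def[symmetric] d_def[symmetric]
        by (simp add: pos_le_divide_eq mult.commute)
      then have ds: "d \<le> s" unfolding s_def by (rule real_le_rsqrt)
      have hs: "h (ctrl k) k = (1 + l) * s" using False by (simp add: h_def l_def s_def)
      have "(1 + l) * d \<le> (1 + l) * s" using ds l by (intro mult_left_mono) auto
      moreover have "l * d \<le> (1 + l) * d" "d \<le> (1 + l) * d"
        using d0 l by (auto simp: algebra_simps)
      ultimately show ?thesis
        unfolding hs disp1[OF k] l_def[symmetric] d_def[symmetric] by linarith
    qed
    then show "norm (x (Suc k) - x k) \<le> h (ctrl k) k" "infdist (x k) (C (ctrl k)) \<le> h (ctrl k) k"
      by auto
  qed
  obtain c where c: "c \<in> (\<Inter>i\<in>I. C i)" and w: "weakly_converges_to x c"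
    using fejer_weak_convergence[OF CC assms(5) fejer lim] by blast
  \<comment> \<open>A strong limit must agree with the weak one, so convergence to some point is
    enough.\<close>
  have strong: "x \<longlonglongrightarrow> c" if "convergent x"
    using that weakly_converges_to_eq_limit[OF w] by (auto simp: convergent_def)
  have "x \<longlonglongrightarrow> c" if fd: "finite_dimensional_vector_space ((*\<^sub>R) :: real \<Rightarrow> 'a \<Rightarrow> 'a) B" for B
    using finite_dimensional_vector_space.finite_Basis[OF fd]
      finite_dimensional_vector_space.span_Basis[OF fd] w
    unfolding span_raw_def[symmetric] by (rule weakly_converges_to_finite_dim)
  moreover have "x \<longlonglongrightarrow> c" if "I\<^sub>1 = {}"
  proof (rule strong, rule convergent_if_step_le_decrease[of "2 * r" x V])
    show "2 * r * norm (x (Suc k) - x k) \<le> V k - V (Suc k)" for k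
      using Vstep0 ctrlI un that by auto
  qed (use r V0 in auto)
  moreover have "x \<longlonglongrightarrow> c" if single: "is_singleton I\<^sub>1"
  proof -
    obtain j where j: "I\<^sub>1 = {j}" using single by (rule is_singletonE)
    define l where "l = lam j"
    have l: "0 < l" "l < 2" using lam[of j] j by (auto simp: l_def)
    \<comment> \<open>An intrepid step of length \<open>a\<close> lowers \<open>V / r\<close> by at
      least \<open>2 * a\<close> and raises the distance to \<open>C j\<close> by at most
      \<open>a\<close>, so \<open>W\<close> drops by at least \<open>a\<close>. A step of
      \<open>T j\<close> from distance \<open>d\<close> has length \<open>l * d\<close> and lowers
      the distance by at least \<open>(1 - \<bar>1 - l\<bar>) * d\<close>, while \<open>V\<close>
      does not increase. Hence the two terms of the minimum.\<close>
    define \<delta> where "\<delta> = min 1 ((1 - \<bar>1 - l\<bar>) / l)"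
    define W where "W k = V k / r + infdist (x k) (C j)" for k
    show ?thesis
    proof (rule strong, rule convergent_if_step_le_decrease[of \<delta> x W])
      show "0 < \<delta>" using l by (auto simp: \<delta>_def)
      show "0 \<le> W k" for k using V0 r by (simp add: W_def infdist_nonneg)
      fix k
      define a where "a = norm (x (Suc k) - x k)"
      have a0: "0 \<le> a" by (simp add: a_def)
      show "\<delta> * norm (x (Suc k) - x k) \<le> W k - W (Suc k)"
      proof (cases "ctrl k \<in> I\<^sub>0")
        case True
        have "\<delta> * a \<le> 1 * a" using a0 by (intro mult_right_mono) (auto simp: \<delta>_def)
        moreover have "2 * a \<le> V k / r - V (Suc k) / r"
          using Vstep0[OF True] r by (simp add: a_def field_simps)
        moreover have "infdist (x (Suc k)) (C j) \<le> infdist (x k) (C j) + a"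
          using infdist_triangle[of "x (Suc k)" "C j" "x k"] by (simp add: a_def dist_norm)
        ultimately show ?thesis unfolding W_def a_def[symmetric] by linarith
      next
        case False
        then have k: "ctrl k \<in> I\<^sub>1" "ctrl k = j" using ctrlI un j by blast+
        define d where "d = infdist (x k) (C j)"
        have "\<delta> * a \<le> (1 - \<bar>1 - l\<bar>) / l * a" using a0 by (intro mult_right_mono) (auto simp: \<delta>_def)
        also have "\<dots> = (1 - \<bar>1 - l\<bar>) * d"
          using disp1[OF k(1)] k(2) l by (simp add: a_def d_def l_def[symmetric])
        also have "\<dots> = d - \<bar>1 - l\<bar> * d" by (simp add: left_diff_distrib)
        also have "\<dots> \<le> d - infdist (x (Suc k)) (C j)"
          using infdist_relaxed_projector_le[OF C1(1-3)[OF k(1)], of l "x k"] step1[OF k(1)] k(2)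
          by (simp add: d_def l_def)
        also have "\<dots> \<le> W k - W (Suc k)"
          using Vdec[of k] r by (simp add: W_def d_def divide_right_mono)
        finally show ?thesis by (simp add: a_def)
      qed
    qed
  qed
  ultimately show ?thesis using c w by blast
qed

end
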